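(* Let $I$ be a positive integer and let $\mathcal{S}_{\mathrm{QS}}^{I^2}\subset\mathcal{S}^{I^2}$ be the set of quasi-symmetric probability tables, i.e. of all $\mathbf{P}\in\mathcal{S}^{I^2}$ with $\mathbf{P}_{\mathrm{int}}=T(\mathbf{P}_{\mathrm{int}})$. Then $\mathcal{S}_{\mathrm{QS}}^{I^2}$ is a linear subspace of the vector space $(\mathcal{S}^{I^2},\oplus,\odot)$, and its dimension is $(I-1)(I+4)/2$.
   Context: $\mathcal{S}^{I^2}$ is the set of all $I\times I$ tables $\mathbf{P}=(p_{ij})$ of real numbers with $p_{ij}>0$ and $\sum_{i,j=1}^{I}p_{ij}=1$ (probability tables). For a table $\mathbf{R}=(r_{ij})$ with positive entries, the closure is $\mathcal{C}\mathbf{R}=\big(r_{ij}/\sum_{k,l}r_{kl}\big)_{ij}$. Perturbation: $\mathbf{P}\oplus\mathbf{Q}=\mathcal{C}(p_{ij}q_{ij})$; powering by $\alpha\in\mathbb{R}$: $\alpha\odot\mathbf{P}=\mathcal{C}(p_{ij}^{\alpha})$; $\mathbf{P}\ominus\mathbf{Q}=\mathbf{P}\oplus((-1)\odot\mathbf{Q})$. With $\oplus$ as addition and $\odot$ as scalar multiplication $\mathcal{S}^{I^2}$ is a real vector space of dimension $I^2-1$. $T(\mathbf{P})$ denotes the transposed table, with $(i,j)$ entry $p_{ji}$. Let $g(row_i[\mathbf{P}])=\big(\prod_{j=1}^{I}p_{ij}\big)^{1/I}$ and $g(col_j[\mathbf{P}])=\big(\prod_{i=1}^{I}p_{ij}\big)^{1/I}$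 be the geometric means of the $i$-th row and $j$-th column. Let $row(\mathbf{P})$ be the closure of the table whose $(i,j)$ entry is $g(row_i[\mathbf{P}])$, and $col(\mathbf{P})$ the closure of the table whose $(i,j)$ entry is $g(col_j[\mathbf{P}])$. The independent component is $\mathbf{P}_{\mathrm{ind}}=row(\mathbf{P})\oplus col(\mathbf{P})$ and the interaction component is $\mathbf{P}_{\mathrm{int}}=\mathbf{P}\ominus\mathbf{P}_{\mathrm{ind}}$, so $\mathbf{P}=\mathbf{P}_{\mathrm{ind}}\oplus\mathbf{P}_{\mathrm{int}}$. *)

theory Defs
  imports "HOL-Analysis.Analysis"
begin

text \<open>
  The index set of size \<open>I\<close> is a finite type \<open>'n\<close> with \<open>I = CARD('n)\<close>; \<open>P $ i $ j\<close> is the entry in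
  row \<open>i\<close> and column \<open>j\<close>.
\<close>

typedef 'n prob_table =
    "{P :: real^'n^'n::finite. (\<forall>i j. P $ i $ j > 0) \<and> (\<Sum>i\<in>UNIV. \<Sum>j\<in>UNIV. P $ i $ j) = 1}"
  morphisms entries Abs_prob_table
  by (rule exI[of _ "\<chi> i j. 1 / (real CARD('n) * real CARD('n))"]) simp

setup_lifting type_definition_prob_table

text \<open>The closure operator of compositional data analysis, not the topological closure.\<close>

definition table_closure :: "real^'n^'n::finite \<Rightarrow> real^'n^'n" where
  "table_closure R = (\<chi> i j. R $ i $ j / (\<Sum>k\<in>UNIV. \<Sum>l\<in>UNIV. R $ k $ l))"

lemma table_sum_pos:
  fixes R :: "real^'n^'n::finite"
  assumes "\<And>i j. R $ i $ j > 0"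
  shows "(\<Sum>k\<in>UNIV. \<Sum>l\<in>UNIV. R $ k $ l) > 0"
  by (intro sum_pos) (auto simp: assms)

lemma table_closure_prob_table:
  fixes R :: "real^'n^'n::finite"
  assumes "\<And>i j. R $ i $ j > 0"
  shows "(\<forall>i j. table_closure R $ i $ j > 0) \<and>
    (\<Sum>i\<in>UNIV. \<Sum>j\<in>UNIV. table_closure R $ i $ j) = 1"
  using table_sum_pos[OF assms] assms
  by (simp add: table_closure_def sum_divide_distrib[symmetric])

lemma table_closure_factor:
  fixes R :: "real^'n^'n::finite"
  assumes "\<And>i j. R $ i $ j > 0"
  obtains s where "s > 0" "\<And>i j. table_closure R $ i $ j = s * R $ i $ j"
  using table_sum_pos[OF assms]
  by (intro that[of "1 / (\<Sum>k\<in>UNIV. \<Sum>l\<in>UNIV. R $ k $ l)"]) (simp_all add: table_closure_def)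

lemma entries_pos: "entries P $ i $ j > 0"
  by transfer simp

lemma prob_table_eqI:
  assumes "\<And>i j. entries P $ i $ j = c * entries Q $ i $ j"
  shows "P = Q"
proof -
  have "(\<Sum>i\<in>UNIV. \<Sum>j\<in>UNIV. entries P $ i $ j) = c * (\<Sum>i\<in>UNIV. \<Sum>j\<in>UNIV. entries Q $ i $ j)"
    by (simp add: assms sum_distrib_left)
  moreover have "(\<Sum>i\<in>UNIV. \<Sum>j\<in>UNIV. entries R $ i $ j) = 1" for R :: "'a prob_table"
    by transfer simp
  ultimately have "c = 1" by simp
  then have "entries P = entries Q"
    by (simp add: assms vec_eq_iff)
  then show ?thesis by (simp add: entries_inject)
qed

text \<open>
  The vector space structure on probability tables: \<open>+\<close> is perturbation, \<open>*\<^sub>R\<close> is powering, and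
  \<open>0\<close> is the uniform table.
\<close>

instantiation prob_table :: (finite) real_vector
begin

lift_definition zero_prob_table :: "'a prob_table" is "table_closure (\<chi> i j. 1)"
  by (rule table_closure_prob_table) simp

lift_definition plus_prob_table :: "'a prob_table \<Rightarrow> 'a prob_table \<Rightarrow> 'a prob_table" is
  "\<lambda>P Q. table_closure (\<chi> i j. P $ i $ j * Q $ i $ j)"
  by (rule table_closure_prob_table) simp

lift_definition scaleR_prob_table :: "real \<Rightarrow> 'a prob_table \<Rightarrow> 'a prob_table" is
  "\<lambda>a P. table_closure (\<chi> i j. P $ i $ j powr a)"
  by (rule table_closure_prob_table) (simp add: less_imp_neq[symmetric])

definition uminus_prob_table :: "'a prob_table \<Rightarrow> 'a prob_table" where
  "- (P :: 'a prob_table) = (-1) *\<^sub>R P"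

definition minus_prob_table :: "'a prob_table \<Rightarrow> 'a prob_table \<Rightarrow> 'a prob_table" where
  "P - (Q :: 'a prob_table) = P + (-1) *\<^sub>R Q"

lemma plus_factor:
  fixes P Q :: "'a prob_table"
  obtains s where "s > 0"
    "\<And>i j. entries (P + Q) $ i $ j = s * (entries P $ i $ j * entries Q $ i $ j)"
  using table_closure_factor[of "\<chi> i j. entries P $ i $ j * entries Q $ i $ j"]
  by (auto simp: plus_prob_table.rep_eq entries_pos)

lemma scaleR_factor:
  fixes P :: "'a prob_table"
  obtains s where "s > 0" "\<And>i j. entries (a *\<^sub>R P) $ i $ j = s * (entries P $ i $ j powr a)"
proof (rule table_closure_factor[of "\<chi> i j. entries P $ i $ j powr a"])
  show "(\<chi> i j. entries P $ i $ j powr a) $ i $ j > 0" for i j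
    using entries_pos[of P i j] by simp
qed (auto simp: scaleR_prob_table.rep_eq intro: that)

lemma zero_factor:
  obtains s where "s > 0" "\<And>i j. entries (0 :: 'a prob_table) $ i $ j = s"
  using table_closure_factor[of "(\<chi> i j. 1) :: real^'a^'a"]
  by (auto simp: zero_prob_table.rep_eq)

instance
proof
  fix P Q R :: "'a prob_table" and a b :: real
  note pos = entries_pos[THEN less_imp_le] entries_pos[THEN less_imp_neq, symmetric]
  show "P + Q + R = P + (Q + R)"
  proof -
    obtain s where s: "s > 0" "\<And>i j. entries (P + Q) $ i $ j = s * (entries P $ i $ j * entries Q $ i $ j)"
      using plus_factor[of P Q] by blast
    obtain t where t: "t > 0" "\<And>i j. entries (P + Q + R) $ i $ j = t * (entries (P + Q) $ i $ j * entries R $ i $ j)"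
      using plus_factor[of "P + Q" R] by blast
    obtain u where u: "u > 0" "\<And>i j. entries (Q + R) $ i $ j = u * (entries Q $ i $ j * entries R $ i $ j)"
      using plus_factor[of Q R] by blast
    obtain v where v: "v > 0" "\<And>i j. entries (P + (Q + R)) $ i $ j = v * (entries P $ i $ j * entries (Q + R) $ i $ j)"
      using plus_factor[of P "Q + R"] by blast
    show ?thesis
      by (rule prob_table_eqI[where c = "s * t / (u * v)"]) (use s t u v in simp)
  qed
  show "P + Q = Q + P"
    by transfer (simp add: mult.commute)
  show "0 + P = P"
  proof -
    obtain s where s: "s > 0" "\<And>i j. entries (0 :: 'a prob_table) $ i $ j = s"
      using zero_factor by blast
    obtain t where t: "t > 0" "\<And>i j. entries (0 + P) $ i $ j = t * (entries 0 $ i $ j * entries P $ i $ j)"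
      using plus_factor[of 0 P] by blast
    show ?thesis
      by (rule prob_table_eqI[where c = "s * t"]) (use s t in simp)
  qed
  show "- P + P = 0"
  proof -
    obtain s where s: "s > 0" "\<And>i j. entries (0 :: 'a prob_table) $ i $ j = s"
      using zero_factor by blast
    obtain t where t: "t > 0" "\<And>i j. entries (- P) $ i $ j = t * (entries P $ i $ j powr (-1))"
      using scaleR_factor[of "-1" P] by (auto simp: uminus_prob_table_def)
    obtain u where u: "u > 0" "\<And>i j. entries (- P + P) $ i $ j = u * (entries (- P) $ i $ j * entries P $ i $ j)"
      using plus_factor[of "- P" P] by blast
    show ?thesis
      by (rule prob_table_eqI[where c = "t * u / s"]) (use s t u in \<open>simp add: powr_minus pos\<close>)
  qed
  show "P - Q = P + - Q"
    by (simp add: minus_prob_table_def uminus_prob_table_def)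
  show "a *\<^sub>R (P + Q) = a *\<^sub>R P + a *\<^sub>R Q"
  proof -
    obtain s where s: "s > 0" "\<And>i j. entries (P + Q) $ i $ j = s * (entries P $ i $ j * entries Q $ i $ j)"
      using plus_factor[of P Q] by blast
    obtain t where t: "t > 0" "\<And>i j. entries (a *\<^sub>R (P + Q)) $ i $ j = t * (entries (P + Q) $ i $ j powr a)"
      using scaleR_factor[of a "P + Q"] by blast
    obtain u where u: "u > 0" "\<And>i j. entries (a *\<^sub>R P) $ i $ j = u * (entries P $ i $ j powr a)"
      using scaleR_factor[of a P] by blast
    obtain v where v: "v > 0" "\<And>i j. entries (a *\<^sub>R Q) $ i $ j = v * (entries Q $ i $ j powr a)"
      using scaleR_factor[of a Q] by blast
    obtain w where w: "w > 0" "\<And>i j. entries (a *\<^sub>R P + a *\<^sub>R Q) $ i $ j = w * (entries (a *\<^sub>R P) $ i $ j * entries (a *\<^sub>R Q) $ i $ j)"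
      using plus_factor[of "a *\<^sub>R P" "a *\<^sub>R Q"] by blast
    show ?thesis
      by (rule prob_table_eqI[where c = "t * s powr a / (u * v * w)"])
         (use s t u v w in \<open>simp add: powr_mult pos\<close>)
  qed
  show "(a + b) *\<^sub>R P = a *\<^sub>R P + b *\<^sub>R P"
  proof -
    obtain t where t: "t > 0" "\<And>i j. entries ((a + b) *\<^sub>R P) $ i $ j = t * (entries P $ i $ j powr (a + b))"
      using scaleR_factor[of "a + b" P] by blast
    obtain u where u: "u > 0" "\<And>i j. entries (a *\<^sub>R P) $ i $ j = u * (entries P $ i $ j powr a)"
      using scaleR_factor[of a P] by blast
    obtain v where v: "v > 0" "\<And>i j. entries (b *\<^sub>R P) $ i $ j = v * (entries P $ i $ j powr b)"
      using scaleR_factor[of b P] by blast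
    obtain w where w: "w > 0" "\<And>i j. entries (a *\<^sub>R P + b *\<^sub>R P) $ i $ j = w * (entries (a *\<^sub>R P) $ i $ j * entries (b *\<^sub>R P) $ i $ j)"
      using plus_factor[of "a *\<^sub>R P" "b *\<^sub>R P"] by blast
    show ?thesis
      by (rule prob_table_eqI[where c = "t / (u * v * w)"])
         (use t u v w in \<open>simp add: powr_add pos\<close>)
  qed
  show "a *\<^sub>R b *\<^sub>R P = (a * b) *\<^sub>R P"
  proof -
    obtain t where t: "t > 0" "\<And>i j. entries ((a * b) *\<^sub>R P) $ i $ j = t * (entries P $ i $ j powr (a * b))"
      using scaleR_factor[of "a * b" P] by blast
    obtain u where u: "u > 0" "\<And>i j. entries (b *\<^sub>R P) $ i $ j = u * (entries P $ i $ j powr b)"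
      using scaleR_factor[of b P] by blast
    obtain v where v: "v > 0" "\<And>i j. entries (a *\<^sub>R b *\<^sub>R P) $ i $ j = v * (entries (b *\<^sub>R P) $ i $ j powr a)"
      using scaleR_factor[of a "b *\<^sub>R P"] by blast
    show ?thesis
      by (rule prob_table_eqI[where c = "v * u powr a / t"])
         (use t u v in \<open>simp add: powr_mult powr_powr mult.commute pos\<close>)
  qed
  show "1 *\<^sub>R P = P"
  proof -
    obtain t where t: "t > 0" "\<And>i j. entries (1 *\<^sub>R P) $ i $ j = t * (entries P $ i $ j powr 1)"
      using scaleR_factor[of 1 P] by blast
    show ?thesis
      by (rule prob_table_eqI[where c = t]) (use t in \<open>simp add: pos\<close>)
  qed
qed

end

lift_definition transpose_table :: "'n::finite prob_table \<Rightarrow> 'n prob_table" is transpose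
  by (auto simp: transpose_def intro: trans[OF sum.swap])

definition geo_row :: "real^'n^'n::finite \<Rightarrow> 'n \<Rightarrow> real" where
  "geo_row P i = (\<Prod>j\<in>UNIV. P $ i $ j) powr (1 / real CARD('n))"

definition geo_col :: "real^'n^'n::finite \<Rightarrow> 'n \<Rightarrow> real" where
  "geo_col P j = (\<Prod>i\<in>UNIV. P $ i $ j) powr (1 / real CARD('n))"

lift_definition row_table :: "'n::finite prob_table \<Rightarrow> 'n prob_table" is
  "\<lambda>P. table_closure (\<chi> i j. geo_row P i)"
  by (rule table_closure_prob_table) (simp add: geo_row_def prod_pos less_imp_neq[symmetric])

lift_definition col_table :: "'n::finite prob_table \<Rightarrow> 'n prob_table" is
  "\<lambda>P. table_closure (\<chi> i j. geo_col P j)"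
  by (rule table_closure_prob_table) (simp add: geo_col_def prod_pos less_imp_neq[symmetric])

definition independent_part :: "'n::finite prob_table \<Rightarrow> 'n prob_table" where
  "independent_part P = row_table P + col_table P"

definition interaction_part :: "'n::finite prob_table \<Rightarrow> 'n prob_table" where
  "interaction_part P = P - independent_part P"

definition quasi_symmetric_tables :: "'n::finite prob_table set" where
  "quasi_symmetric_tables = {P. interaction_part P = transpose_table (interaction_part P)}"

end

theory Submission imports Defs begin

text \<open>
  In logarithmic coordinates \<open>A = ln P\<close>, quasi-symmetry says \<open>A\<^sub>i\<^sub>j - A\<^sub>j\<^sub>i = f\<^sub>i - f\<^sub>j\<close> for some
  vector \<open>f\<close>. Order the indices with \<open>k\<close> as the least one. A quasi-symmetric table is then determined,
  up to an additive constant of \<open>A\<close>, by its upper triangle and its column \<open>k\<close> (which yields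
  \<open>f\<^sub>i - f\<^sub>k = A\<^sub>i\<^sub>k - A\<^sub>k\<^sub>i\<close>), and these entries can be prescribed freely. The constant is removed by
  subtracting \<open>A\<^sub>k\<^sub>k\<close>, so the dimension is \<open>I(I+1)/2 + (I-1) - 1\<close>.
\<close>

text \<open>Applying \<open>\<phi> j\<close> to a linear combination of the \<open>x k\<close> reads
  off its \<open>j\<close>-th coefficient, so the family is independent. Any \<open>v\<close> minus
  its expansion with coefficients \<open>\<phi> k v\<close> lies in \<open>V\<close> and is killed
  by every functional, so \<open>sep\<close> makes the family span.\<close>

lemma dim_eq_card_biorthogonal:
  fixes \<phi> :: "'j \<Rightarrow> 'a::real_vector \<Rightarrow> real" and x :: "'j \<Rightarrow> 'a"
  assumes fin: "finite J" and V: "subspace V"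
    and lin: "\<And>j. j \<in> J \<Longrightarrow> linear (\<phi> j)"
    and x: "\<And>j. j \<in> J \<Longrightarrow> x j \<in> V"
    and dual: "\<And>j k. j \<in> J \<Longrightarrow> k \<in> J \<Longrightarrow> \<phi> j (x k) = (if j = k then 1 else 0)"
    and sep: "\<And>v. v \<in> V \<Longrightarrow> (\<And>j. j \<in> J \<Longrightarrow> \<phi> j v = 0) \<Longrightarrow> v = 0"
  shows "dim V = card J"
proof -
  have coord: "\<phi> j (\<Sum>k\<in>J. c k *\<^sub>R x k) = c j" if "j \<in> J" for c j
  proof -
    have "\<phi> j (\<Sum>k\<in>J. c k *\<^sub>R x k) = (\<Sum>k\<in>J. c k * \<phi> j (x k))"
      by (simp add: linear_sum[OF lin[OF that]] linear_scale[OF lin[OF that]])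
    also have "\<dots> = (\<Sum>k\<in>J. if j = k then c k else 0)"
      by (intro sum.cong) (auto simp: dual that)
    finally show ?thesis using fin that by simp
  qed
  have inj: "inj_on x J"
    by (rule inj_onI) (metis dual zero_neq_one)
  have indep: "independent (x ` J)"
  proof (rule independent_if_scalars_zero)
    show "finite (x ` J)" using fin by simp
    fix c y assume "(\<Sum>y\<in>x ` J. c y *\<^sub>R y) = 0" and "y \<in> x ` J"
    then obtain j where j: "j \<in> J" "y = x j" and "(\<Sum>k\<in>J. c (x k) *\<^sub>R x k) = 0"
      using inj by (auto simp: sum.reindex)
    then show "c y = 0"
      using coord[of j "\<lambda>k. c (x k)"] linear_0[OF lin] by simp
  qed
  have "V \<subseteq> span (x ` J)"
  proof
    fix v assume v: "v \<in> V"
    let ?w = "\<Sum>k\<in>J. \<phi> k v *\<^sub>R x k"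
    have "?w \<in> V"
      by (intro subspace_sum subspace_scale V x)
    then have "v - ?w = 0"
      by (intro sep) (simp_all add: subspace_diff V v coord linear_diff[OF lin])
    then have "v = ?w" by simp
    also have "?w \<in> span (x ` J)"
      by (intro span_sum span_scale span_base imageI)
    finally show "v \<in> span (x ` J)" .
  qed
  then have "span (x ` J) = V"
    using x by (intro span_subspace V) blast
  then have "dim V = card (x ` J)"
    using dim_span_eq_card_independent[OF indep] by simp
  then show ?thesis using inj by (simp add: card_image)
qed

section \<open>Logarithmic coordinates\<close>

text \<open>A single log entry is not linear, because closure rescales the table. In a difference of
  two log entries the scaling factor cancels.\<close>

definition log_ratio :: "'n \<times> 'n \<Rightarrow> 'n \<times> 'n \<Rightarrow> 'n::finite prob_table \<Rightarrow> real" where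
  "log_ratio p q P =
     ln (entries P $ fst p $ snd p) - ln (entries P $ fst q $ snd q)"

lemma linear_log_ratio: "linear (log_ratio p q)"
proof (rule linearI)
  note pos = entries_pos[THEN less_imp_neq, symmetric]
  fix P Q :: "'a prob_table" and c :: real
  show "log_ratio p q (P + Q) = log_ratio p q P + log_ratio p q Q"
    by (rule plus_factor[of P Q]) (simp add: log_ratio_def ln_mult entries_pos pos)
  show "log_ratio p q (c *\<^sub>R P) = c *\<^sub>R log_ratio p q P"
    by (rule scaleR_factor[of c P])
      (simp add: log_ratio_def ln_mult ln_powr entries_pos pos algebra_simps)
qed

text \<open>All entries agree with the one at \<open>q\<close>, so the table is uniform.\<close>

lemma prob_table_eq_0I:
  assumes "\<And>p. log_ratio p q P = 0"
  shows "P = 0"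
proof -
  obtain s where s: "s > 0" "\<And>i j. entries (0 :: 'a prob_table) $ i $ j = s"
    using zero_factor by blast
  let ?e = "entries P $ fst q $ snd q"
  have "entries P $ i $ j = ?e" for i j
    using assms[of "(i, j)"] by (simp add: log_ratio_def entries_pos)
  then show ?thesis
    using s by (intro prob_table_eqI[where c = "?e / s"]) simp
qed

text \<open>Exponentiate \<open>A\<close> and close; the closure factor cancels in every log
  ratio.\<close>

lemma prob_table_with_log_ratios:
  fixes A :: "'n::finite \<Rightarrow> 'n \<Rightarrow> real"
  obtains P where "\<And>p q. log_ratio p q P = A (fst p) (snd p) - A (fst q) (snd q)"
proof -
  let ?R = "(\<chi> i j. exp (A i j)) :: real^'n^'n"
  have pos: "?R $ i $ j > 0" for i j by simp
  define P where "P = Abs_prob_table (table_closure ?R)"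
  have P: "entries P = table_closure ?R"
    unfolding P_def using table_closure_prob_table[of ?R] pos
    by (intro Abs_prob_table_inverse) blast
  obtain s where "s > 0" "\<And>i j. table_closure ?R $ i $ j = s * ?R $ i $ j"
    using table_closure_factor[of ?R] pos by blast
  then show ?thesis
    by (intro that[of P]) (simp add: log_ratio_def P ln_mult)
qed

section \<open>Quasi-symmetry in logarithmic coordinates\<close>

lemma ln_geo_row:
  fixes R :: "real^'n^'n::finite"
  assumes "\<And>i j. R $ i $ j > 0"
  shows "real CARD('n) * ln (geo_row R i) = (\<Sum>j\<in>UNIV. ln (R $ i $ j))"
  using assms by (simp add: geo_row_def ln_powr ln_prod less_imp_neq[symmetric])

lemma ln_geo_col:
  fixes R :: "real^'n^'n::finite"
  assumes "\<And>i j. R $ i $ j > 0"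
  shows "real CARD('n) * ln (geo_col R j) = (\<Sum>i\<in>UNIV. ln (R $ i $ j))"
  using assms by (simp add: geo_col_def ln_powr ln_prod less_imp_neq[symmetric])

lemma geo_pos:
  fixes R :: "real^'n^'n::finite"
  assumes "\<And>i j. R $ i $ j > 0"
  shows "geo_row R i > 0" "geo_col R j > 0"
  using assms by (simp_all add: geo_row_def geo_col_def less_imp_neq[symmetric])

lemma ln_row_table:
  obtains c where "\<And>i j. ln (entries (row_table P) $ i $ j) = c + ln (geo_row (entries P) i)"
proof -
  note pos = geo_pos(1)[of "entries P", OF entries_pos]
  obtain s where "s > 0" "\<And>i j. entries (row_table P) $ i $ j = s * geo_row (entries P) i"
    using table_closure_factor[of "\<chi> i j. geo_row (entries P) i"] pos
    by (auto simp: row_table.rep_eq)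
  then show ?thesis
    using pos by (intro that[of "ln s"]) (simp add: ln_mult pos[THEN less_imp_neq, symmetric])
qed

lemma ln_col_table:
  obtains c where "\<And>i j. ln (entries (col_table P) $ i $ j) = c + ln (geo_col (entries P) j)"
proof -
  note pos = geo_pos(2)[of "entries P", OF entries_pos]
  obtain s where "s > 0" "\<And>i j. entries (col_table P) $ i $ j = s * geo_col (entries P) j"
    using table_closure_factor[of "\<chi> i j. geo_col (entries P) j"] pos
    by (auto simp: col_table.rep_eq)
  then show ?thesis
    using pos by (intro that[of "ln s"]) (simp add: ln_mult pos[THEN less_imp_neq, symmetric])
qed

lemma log_ratio_interaction_part:
  "log_ratio (i, j) (k, l) (interaction_part P) =
     log_ratio (i, j) (k, l) P
     - (ln (geo_row (entries P) i) - ln (geo_row (entries P) k))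
     - (ln (geo_col (entries P) j) - ln (geo_col (entries P) l))"
proof -
  obtain c where c: "\<And>i j. ln (entries (row_table P) $ i $ j) = c + ln (geo_row (entries P) i)"
    using ln_row_table[of P] by blast
  obtain d where d: "\<And>i j. ln (entries (col_table P) $ i $ j) = d + ln (geo_col (entries P) j)"
    using ln_col_table[of P] by blast
  have "log_ratio (i, j) (k, l) (row_table P) = ln (geo_row (entries P) i) - ln (geo_row (entries P) k)"
    "log_ratio (i, j) (k, l) (col_table P) = ln (geo_col (entries P) j) - ln (geo_col (entries P) l)"
    by (simp_all add: log_ratio_def c d)
  then show ?thesis
    by (simp add: interaction_part_def independent_part_def
        linear_diff[OF linear_log_ratio] linear_add[OF linear_log_ratio])
qed

lemma table_symmetric_iff:
  "P = transpose_table P \<longleftrightarrow> (\<forall>i j. log_ratio (i, j) (j, i) P = 0)"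
proof -
  have "P = transpose_table P \<longleftrightarrow> (\<forall>i j. entries P $ i $ j = entries P $ j $ i)"
    by (simp add: entries_inject[symmetric] transpose_table.rep_eq transpose_def vec_eq_iff)
  then show ?thesis by (simp add: log_ratio_def entries_pos)
qed

text \<open>Symmetry of the interaction part is the case of one specific potential,
  \<open>h\<close>. Averaging \<open>f i - f j\<close> over \<open>j\<close> gives
  \<open>f i\<close> minus the mean of \<open>f\<close>, so any admissible \<open>f\<close> differs
  from \<open>h\<close> by a constant. Allowing every \<open>f\<close> makes linearity and the
  construction of tables easy.\<close>

lemma quasi_symmetric_iff:
  fixes P :: "'n::finite prob_table"
  shows "P \<in> quasi_symmetric_tables \<longleftrightarrow> (\<exists>f. \<forall>i j. log_ratio (i, j) (j, i) P = f i - f j)"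
proof -
  define h where "h i = ln (geo_row (entries P) i) - ln (geo_col (entries P) i)" for i
  have h: "real CARD('n) * h i = (\<Sum>j\<in>UNIV. log_ratio (i, j) (j, i) P)" for i
    using ln_geo_row[of "entries P" i] ln_geo_col[of "entries P" i]
    by (simp add: h_def log_ratio_def entries_pos right_diff_distrib sum_subtractf)
  have "P \<in> quasi_symmetric_tables \<longleftrightarrow> (\<forall>i j. log_ratio (i, j) (j, i) P = h i - h j)"
    unfolding quasi_symmetric_tables_def mem_Collect_eq table_symmetric_iff
      log_ratio_interaction_part h_def by (simp add: algebra_simps)
  moreover have "h i - h j = f i - f j"
    if f: "\<forall>i j. log_ratio (i, j) (j, i) P = f i - f j" for f i j
  proof -
    have "real CARD('n) * h i = real CARD('n) * f i - sum f UNIV" for i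
      by (simp add: h f sum_subtractf)
    then have "real CARD('n) * (h i - h j) = real CARD('n) * (f i - f j)"
      by (simp add: right_diff_distrib)
    then show ?thesis by simp
  qed
  ultimately show ?thesis by metis
qed

lemma subspace_quasi_symmetric_tables: "subspace quasi_symmetric_tables"
proof (rule subspaceI)
  fix P Q :: "'a prob_table" and c :: real
  show "(0 :: 'a prob_table) \<in> quasi_symmetric_tables"
    unfolding quasi_symmetric_iff by (rule exI[of _ "\<lambda>_. 0"]) (simp add: linear_0[OF linear_log_ratio])
  assume "P \<in> quasi_symmetric_tables"
  then obtain f where f: "\<And>i j. log_ratio (i, j) (j, i) P = f i - f j"
    unfolding quasi_symmetric_iff by blast
  show "c *\<^sub>R P \<in> quasi_symmetric_tables"
    unfolding quasi_symmetric_iff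
    by (rule exI[of _ "\<lambda>i. c * f i"]) (simp add: linear_scale[OF linear_log_ratio] f algebra_simps)
  assume "Q \<in> quasi_symmetric_tables"
  then obtain g where g: "\<And>i j. log_ratio (i, j) (j, i) Q = g i - g j"
    unfolding quasi_symmetric_iff by blast
  show "P + Q \<in> quasi_symmetric_tables"
    unfolding quasi_symmetric_iff
    by (rule exI[of _ "\<lambda>i. f i + g i"]) (simp add: linear_add[OF linear_log_ratio] f g)
qed

section \<open>Free entries and their number\<close>

text \<open>Upper triangle for the order induced by \<open>e\<close>, together with column
  \<open>k\<close>. The cell \<open>(k, k)\<close> is left out as the reference cell of the log
  ratios.\<close>

definition free_entries :: "('n \<Rightarrow> nat) \<Rightarrow> 'n \<Rightarrow> ('n \<times> 'n) set" where
  "free_entries e k = {(i, j). (e i \<le> e j \<or> j = k) \<and> (i, j) \<noteq> (k, k)}"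

text \<open>The two triangles have equal size by transposition, cover the square and meet in the
  diagonal.\<close>

lemma card_upper_triangle:
  fixes e :: "'n::finite \<Rightarrow> nat"
  assumes "inj e"
  shows "2 * card {(i, j). e i \<le> e j} = CARD('n) * (CARD('n) + 1)"
proof -
  let ?U = "{(i, j). e i \<le> e j}" and ?L = "{(i, j). e j \<le> e i}"
  have L: "card ?L = card ?U"
    by (rule bij_betw_same_card[of prod.swap])
       (auto simp: bij_betw_def inj_on_def image_iff)
  have "card ?U + card ?L = card (?U \<union> ?L) + card (?U \<inter> ?L)"
    by (rule card_Un_Int) simp_all
  also have "?U \<union> ?L = UNIV" by auto
  also have "?U \<inter> ?L = (\<lambda>i. (i, i)) ` UNIV"
    using assms by (auto simp: inj_def)
  also have "card \<dots> = CARD('n)"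
    by (simp add: card_image inj_on_def)
  finally show ?thesis by (simp add: L)
qed

lemma card_free_entries:
  fixes e :: "'n::finite \<Rightarrow> nat"
  assumes "inj e" and "\<And>i. e k \<le> e i"
  shows "real (card (free_entries e k)) = (real CARD('n) - 1) * (real CARD('n) + 4) / 2"
proof -
  let ?U = "{(i, j). e i \<le> e j}" and ?C = "(\<lambda>i. (i, k)) ` (UNIV - {k})"
  \<comment> \<open>With the reference cell restored, the set splits disjointly: \<open>k\<close> is
    the least index, so column \<open>k\<close> meets the upper triangle only in
    \<open>(k, k)\<close>.\<close>
  have "insert (k, k) (free_entries e k) = ?U \<union> ?C"
    by (auto simp: free_entries_def)
  moreover have "card (insert (k, k) (free_entries e k)) = Suc (card (free_entries e k))"
    by (rule card_insert_disjoint) (auto simp: free_entries_def)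
  moreover have "card (?U \<union> ?C) = card ?U + card ?C"
    using assms by (intro card_Un_disjoint) (auto simp: inj_def intro: antisym)
  moreover have "card ?C = CARD('n) - 1"
    by (simp add: card_image inj_on_def card_Diff_singleton)
  ultimately have "real (card (free_entries e k)) + 1 = real (card ?U) + (real CARD('n) - 1)"
    by (simp add: Suc_leI)
  moreover have "2 * real (card ?U) = real CARD('n) * (real CARD('n) + 1)"
    using arg_cong[OF card_upper_triangle[OF assms(1)], of real] by (simp add: algebra_simps)
  ultimately show ?thesis by (simp add: field_simps)
qed

lemma quasi_symmetric_with_free_entries:
  fixes e :: "'n::finite \<Rightarrow> nat" and v :: "'n \<times> 'n \<Rightarrow> real"
  assumes "inj e" and min: "\<And>i. e k \<le> e i"
  obtains P where "P \<in> quasi_symmetric_tables"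
    "\<And>p. p \<in> free_entries e k \<Longrightarrow> log_ratio p (k, k) P = v p"
proof -
  \<comment> \<open>The value 0 at the reference cell gives \<open>f k = 0\<close> and
    \<open>A k k = 0\<close>, so log ratios against \<open>(k, k)\<close> are the entries of
    \<open>A\<close>. Below the diagonal, \<open>A\<close> is forced by quasi-symmetry; in column
    \<open>k\<close> this returns \<open>w (k, i) + f i = w (i, k)\<close>, as prescribed.\<close>
  define w where "w p = (if p = (k, k) then 0 else v p)" for p
  define f where "f i = w (i, k) - w (k, i)" for i
  define A where "A i j = (if e i \<le> e j then w (i, j) else w (j, i) + f i - f j)" for i j
  obtain P where P: "\<And>p q. log_ratio p q P = A (fst p) (snd p) - A (fst q) (snd q)"
    using prob_table_with_log_ratios[of A] by blast
  have eq: "i = j" if "e i \<le> e j" "e j \<le> e i" for i j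
    using that assms(1) by (simp add: inj_eq)
  have "log_ratio (i, j) (j, i) P = f i - f j" for i j
    using eq[of i j] by (auto simp: P A_def)
  then have "P \<in> quasi_symmetric_tables"
    unfolding quasi_symmetric_iff by blast
  moreover have "log_ratio p (k, k) P = v p" if "p \<in> free_entries e k" for p
    using that eq[of "fst p" k] min
    by (auto simp: free_entries_def P A_def f_def w_def)
  ultimately show ?thesis by (rule that)
qed

text \<open>Row \<open>k\<close> and column \<open>k\<close> vanish, which makes \<open>f\<close>
  constant. The table is then symmetric, and the zeros of the upper triangle carry over to the lower
  one.\<close>

lemma quasi_symmetric_eq_0I:
  fixes e :: "'n::finite \<Rightarrow> nat"
  assumes min: "\<And>i. e k \<le> e i"
    and P: "P \<in> quasi_symmetric_tables"
    and 0: "\<And>p. p \<in> free_entries e k \<Longrightarrow> log_ratio p (k, k) P = 0"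
  shows "P = 0"
proof (rule prob_table_eq_0I[of "(k, k)"])
  fix p :: "'n \<times> 'n"
  obtain f where f: "\<And>i j. log_ratio (i, j) (j, i) P = f i - f j"
    using P unfolding quasi_symmetric_iff by blast
  have free: "log_ratio (i, j) (k, k) P = 0" if "e i \<le> e j \<or> j = k" for i j
    using 0[of "(i, j)"] that by (cases "(i, j) = (k, k)") (auto simp: free_entries_def log_ratio_def)
  have swap: "log_ratio (i, j) (j, i) P = log_ratio (i, j) (k, k) P - log_ratio (j, i) (k, k) P" for i j
    by (simp add: log_ratio_def)
  have fk: "f i = f k" for i
    using f[of i k] free[of i k] free[of k i] min by (simp add: swap)
  obtain i j where p: "p = (i, j)" by (cases p)
  show "log_ratio p (k, k) P = 0"
    using f[of i j] free[of i j] free[of j i] fk[of i] fk[of j]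
    by (cases "e i \<le> e j") (simp_all add: p swap)
qed

theorem theorem3:
  "subspace (quasi_symmetric_tables :: 'n::finite prob_table set) \<and>
   real (dim (quasi_symmetric_tables :: 'n prob_table set)) =
     (real CARD('n) - 1) * (real CARD('n) + 4) / 2"
proof -
  obtain e :: "'n \<Rightarrow> nat" where e: "inj e"
    using finite_imp_inj_to_nat_seg[of "UNIV :: 'n set"] by auto
  obtain k where k: "\<And>i. e k \<le> e i"
    using ex_has_least_nat[of "\<lambda>_. True" undefined e] by auto
  let ?J = "free_entries e k"
  \<comment> \<open>Prescribing a Kronecker delta on the free entries yields the family dual to the
    log ratios.\<close>
  have "\<exists>P. P \<in> quasi_symmetric_tables \<and>
      (\<forall>p\<in>?J. log_ratio p (k, k) P = (if p = q then 1 else 0))" for q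
    by (rule quasi_symmetric_with_free_entries[OF e k, where v = "\<lambda>p. if p = q then 1 else 0"]) blast
  then obtain X :: "'n \<times> 'n \<Rightarrow> 'n prob_table"
    where X: "\<And>q. X q \<in> quasi_symmetric_tables"
      "\<And>p q. p \<in> ?J \<Longrightarrow> log_ratio p (k, k) (X q) = (if p = q then 1 else 0)"
    by metis
  have "dim (quasi_symmetric_tables :: 'n prob_table set) = card ?J"
    using X quasi_symmetric_eq_0I[of e k, OF k]
    by (intro dim_eq_card_biorthogonal[where \<phi> = "\<lambda>p. log_ratio p (k, k)" and x = X])
       (auto simp: subspace_quasi_symmetric_tables linear_log_ratio)
  then show ?thesis
    using card_free_entries[OF e k] subspace_quasi_symmetric_tables by simp
qed

end
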